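(* Let $\mathcal{A}$ be a homological category and $(\mathcal{T},\mathcal{F})$ a torsion theory in $\mathcal{A}$ whose reflector $F\colon\mathcal{A}\to\mathcal{F}$ is protoadditive. Let $\Gamma_{\mathcal{F}}$ be the absolute Galois structure on $\mathcal{A}$ induced by the reflection $F$. Then for any effective descent morphism $f\colon A\to B$ in $\mathcal{A}$ the following conditions are equivalent: (1) $f$ is a normal extension with respect to $\Gamma_{\mathcal{F}}$; (2) $f$ is a central extension with respect to $\Gamma_{\mathcal{F}}$; (3) $K[f]\in\mathcal{F}$.
   Context: A category is pointed if it has a zero object $0$; $K[f]$ denotes the kernel object of $f$. A short exact sequence is a composable pair $(k,f)$ with $k=\ker(f)$ and $f=\mathrm{coker}(k)$; a split short exact sequence is a triple $(k,f,s)$ with $k=\ker(f)$, $f\circ s=1$. A pointed category with pullbacks along split epimorphisms is protomodular if the split short five lemma holds. A homological category is a pointed protomodular regular category (regular: finitely complete with pullback-stable (regular epi)-mono factorisations). A functor between pointed protomodular categories is protoadditive if it preserves split short exact sequences. A torsion theory in a pointed category $\mathcal{A}$ is a pair $(\mathcal{T},\mathcal{F})$ of full replete subcategories such that $\mathrm{Hom}_{\mathcal{A}}(T,F)=\{0\}$ for all $T\in\mathcal{T}$, $F\in\mathcal{F}$, and every object $A$ admits a short exact sequence $0\to T\to A\to F\to 0$ with $T\in\mathcal{T}$, $F\in\mathcal{F}$; this gives the reflection unit $\eta_A\colon A\to F(A)$. A morphism $p\colon E\to B$ in $\mathcal{A}$ is an effective descent morphism if the pullback functor $p^*\colon(\mathcal{A}\downarrow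 B)\to(\mathcal{A}\downarrow E)$ is monadic. With respect to the absolute Galois structure $\Gamma_{\mathcal{F}}$ (the reflection $F\colon \mathcal{A}\to\mathcal{F}$ together with the class of all morphisms of $\mathcal{A}$), a morphism $f\colon A\to B$ is: a trivial extension if the naturality square $\eta_B\circ f=F(f)\circ\eta_A$ is a pullback; a central extension if there is an effective descent morphism $p\colon E\to B$ such that the pullback $p^*(f)$ is a trivial extension; a normal extension if $f$ is an effective descent morphism and $f^*(f)$ (a kernel pair projection of $f$) is a trivial extension. *)

theory Defs
  imports Main
begin

section \<open>Categories\<close>

text \<open>Composition is written in the applicative order: \<open>g \<cdot> f\<close> is \<open>g\<close> after \<open>f\<close>.
  All operations are only meaningful on the carriers \<open>Obj C\<close> and \<open>Arr C\<close>.\<close>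

record ('o, 'm) category =
  Obj :: "'o set"
  Arr :: "'m set"
  Dom :: "'m \<Rightarrow> 'o"
  Cod :: "'m \<Rightarrow> 'o"
  Ide :: "'o \<Rightarrow> 'm"
  Comp :: "'m \<Rightarrow> 'm \<Rightarrow> 'm"  (infixl "\<cdot>\<index>" 70)

definition hom :: "('o, 'm) category \<Rightarrow> 'o \<Rightarrow> 'o \<Rightarrow> 'm set" where
  "hom C a b = {f \<in> Arr C. Dom C f = a \<and> Cod C f = b}"

definition is_category :: "('o, 'm) category \<Rightarrow> bool" where
  "is_category C \<longleftrightarrow>
     (\<forall>f\<in>Arr C. Dom C f \<in> Obj C \<and> Cod C f \<in> Obj C) \<and>
     (\<forall>a\<in>Obj C. Ide C a \<in> hom C a a) \<and>
     (\<forall>f\<in>Arr C. \<forall>g\<in>Arr C. Dom C g = Cod C f \<longrightarrow> g \<cdot>\<^bsub>C\<^esub> f \<in> hom C (Dom C f) (Cod C g)) \<and>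
     (\<forall>f\<in>Arr C. f \<cdot>\<^bsub>C\<^esub> Ide C (Dom C f) = f \<and> Ide C (Cod C f) \<cdot>\<^bsub>C\<^esub> f = f) \<and>
     (\<forall>f\<in>Arr C. \<forall>g\<in>Arr C. \<forall>h\<in>Arr C. Dom C g = Cod C f \<longrightarrow> Dom C h = Cod C g \<longrightarrow>
        h \<cdot>\<^bsub>C\<^esub> (g \<cdot>\<^bsub>C\<^esub> f) = (h \<cdot>\<^bsub>C\<^esub> g) \<cdot>\<^bsub>C\<^esub> f)"

definition is_iso :: "('o, 'm) category \<Rightarrow> 'm \<Rightarrow> bool" where
  "is_iso C f \<longleftrightarrow> f \<in> Arr C \<and>
     (\<exists>g\<in>hom C (Cod C f) (Dom C f).
        g \<cdot>\<^bsub>C\<^esub> f = Ide C (Dom C f) \<and> f \<cdot>\<^bsub>C\<^esub> g = Ide C (Cod C f))"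

definition is_mono :: "('o, 'm) category \<Rightarrow> 'm \<Rightarrow> bool" where
  "is_mono C m \<longleftrightarrow> m \<in> Arr C \<and>
     (\<forall>u\<in>Arr C. \<forall>v\<in>Arr C. Dom C u = Dom C v \<longrightarrow> Cod C u = Dom C m \<longrightarrow> Cod C v = Dom C m \<longrightarrow>
        m \<cdot>\<^bsub>C\<^esub> u = m \<cdot>\<^bsub>C\<^esub> v \<longrightarrow> u = v)"

definition is_split_epi :: "('o, 'm) category \<Rightarrow> 'm \<Rightarrow> bool" where
  "is_split_epi C f \<longleftrightarrow> f \<in> Arr C \<and> (\<exists>s\<in>hom C (Cod C f) (Dom C f). f \<cdot>\<^bsub>C\<^esub> s = Ide C (Cod C f))"

text \<open>The full subcategory on the objects in \<open>S\<close>.\<close>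

definition full_subcat :: "('o, 'm) category \<Rightarrow> 'o set \<Rightarrow> ('o, 'm) category" where
  "full_subcat C S = C\<lparr>Obj := Obj C \<inter> S, Arr := {f \<in> Arr C. Dom C f \<in> S \<and> Cod C f \<in> S}\<rparr>"

definition replete :: "('o, 'm) category \<Rightarrow> 'o set \<Rightarrow> bool" where
  "replete C S \<longleftrightarrow> (\<forall>f. is_iso C f \<longrightarrow> Dom C f \<in> S \<longrightarrow> Cod C f \<in> S)"


section \<open>Functors, adjunctions and monads\<close>

record ('o, 'm, 'p, 'n) cfunctor =
  omap :: "'o \<Rightarrow> 'p"
  amap :: "'m \<Rightarrow> 'n"

definition is_functor ::
  "('o, 'm) category \<Rightarrow> ('p, 'n) category \<Rightarrow> ('o, 'm, 'p, 'n) cfunctor \<Rightarrow> bool" where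
  "is_functor C D F \<longleftrightarrow> is_category C \<and> is_category D \<and>
     (\<forall>a\<in>Obj C. omap F a \<in> Obj D) \<and>
     (\<forall>f\<in>Arr C. amap F f \<in> hom D (omap F (Dom C f)) (omap F (Cod C f))) \<and>
     (\<forall>a\<in>Obj C. amap F (Ide C a) = Ide D (omap F a)) \<and>
     (\<forall>f\<in>Arr C. \<forall>g\<in>Arr C. Dom C g = Cod C f \<longrightarrow>
        amap F (g \<cdot>\<^bsub>C\<^esub> f) = amap F g \<cdot>\<^bsub>D\<^esub> amap F f)"

definition id_functor :: "('o, 'm, 'o, 'm) cfunctor" where
  "id_functor = \<lparr>omap = id, amap = id\<rparr>"

definition comp_functor ::
  "('p, 'n, 'q, 'r) cfunctor \<Rightarrow> ('o, 'm, 'p, 'n) cfunctor \<Rightarrow> ('o, 'm, 'q, 'r) cfunctor" where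
  "comp_functor G F = \<lparr>omap = omap G \<circ> omap F, amap = amap G \<circ> amap F\<rparr>"

definition is_nat_trans ::
  "('o, 'm) category \<Rightarrow> ('p, 'n) category \<Rightarrow> ('o, 'm, 'p, 'n) cfunctor \<Rightarrow> ('o, 'm, 'p, 'n) cfunctor
     \<Rightarrow> ('o \<Rightarrow> 'n) \<Rightarrow> bool" where
  "is_nat_trans C D F G \<tau> \<longleftrightarrow> is_functor C D F \<and> is_functor C D G \<and>
     (\<forall>a\<in>Obj C. \<tau> a \<in> hom D (omap F a) (omap G a)) \<and>
     (\<forall>f\<in>Arr C. \<tau> (Cod C f) \<cdot>\<^bsub>D\<^esub> amap F f = amap G f \<cdot>\<^bsub>D\<^esub> \<tau> (Dom C f))"

definition naturally_isomorphic ::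
  "('o, 'm) category \<Rightarrow> ('p, 'n) category \<Rightarrow> ('o, 'm, 'p, 'n) cfunctor \<Rightarrow> ('o, 'm, 'p, 'n) cfunctor
     \<Rightarrow> bool" where
  "naturally_isomorphic C D F G \<longleftrightarrow>
     (\<exists>\<tau>. is_nat_trans C D F G \<tau> \<and> (\<forall>a\<in>Obj C. is_iso D (\<tau> a)))"

definition is_equivalence ::
  "('o, 'm) category \<Rightarrow> ('p, 'n) category \<Rightarrow> ('o, 'm, 'p, 'n) cfunctor \<Rightarrow> bool" where
  "is_equivalence C D F \<longleftrightarrow> is_functor C D F \<and>
     (\<exists>G. is_functor D C G \<and>
          naturally_isomorphic C C (comp_functor G F) id_functor \<and>
          naturally_isomorphic D D (comp_functor F G) id_functor)"

text \<open>\<open>is_adjunction C D L G \<eta> \<epsilon>\<close>: the functor \<open>L : D \<rightarrow> C\<close> is left adjoint to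
  \<open>G : C \<rightarrow> D\<close>, with unit \<open>\<eta>\<close> and counit \<open>\<epsilon>\<close>.\<close>

definition is_adjunction ::
  "('o, 'm) category \<Rightarrow> ('p, 'n) category \<Rightarrow> ('p, 'n, 'o, 'm) cfunctor \<Rightarrow> ('o, 'm, 'p, 'n) cfunctor
     \<Rightarrow> ('p \<Rightarrow> 'n) \<Rightarrow> ('o \<Rightarrow> 'm) \<Rightarrow> bool" where
  "is_adjunction C D L G \<eta> \<epsilon> \<longleftrightarrow>
     is_functor D C L \<and> is_functor C D G \<and>
     is_nat_trans D D id_functor (comp_functor G L) \<eta> \<and>
     is_nat_trans C C (comp_functor L G) id_functor \<epsilon> \<and>
     (\<forall>d\<in>Obj D. \<epsilon> (omap L d) \<cdot>\<^bsub>C\<^esub> amap L (\<eta> d) = Ide C (omap L d)) \<and>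
     (\<forall>c\<in>Obj C. amap G (\<epsilon> c) \<cdot>\<^bsub>D\<^esub> \<eta> (omap G c) = Ide D (omap G c))"

text \<open>The Eilenberg--Moore category of a monad \<open>(T, \<eta>, \<mu>)\<close> on \<open>D\<close>. Its objects are the algebras
  \<open>(d, h)\<close> with \<open>h : T d \<rightarrow> d\<close>; an arrow carries its domain and codomain algebras.\<close>

definition em_algebras ::
  "('p, 'n) category \<Rightarrow> ('p, 'n, 'p, 'n) cfunctor \<Rightarrow> ('p \<Rightarrow> 'n) \<Rightarrow> ('p \<Rightarrow> 'n) \<Rightarrow> ('p \<times> 'n) set" where
  "em_algebras D T \<eta> \<mu> = {(d, h). d \<in> Obj D \<and> h \<in> hom D (omap T d) d \<and>
     h \<cdot>\<^bsub>D\<^esub> \<eta> d = Ide D d \<and> h \<cdot>\<^bsub>D\<^esub> amap T h = h \<cdot>\<^bsub>D\<^esub> \<mu> d}"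

definition em_category ::
  "('p, 'n) category \<Rightarrow> ('p, 'n, 'p, 'n) cfunctor \<Rightarrow> ('p \<Rightarrow> 'n) \<Rightarrow> ('p \<Rightarrow> 'n)
     \<Rightarrow> ('p \<times> 'n, ('p \<times> 'n) \<times> 'n \<times> ('p \<times> 'n)) category" where
  "em_category D T \<eta> \<mu> =
     \<lparr>Obj = em_algebras D T \<eta> \<mu>,
      Arr = {(x, f, y). x \<in> em_algebras D T \<eta> \<mu> \<and> y \<in> em_algebras D T \<eta> \<mu> \<and>
               f \<in> hom D (fst x) (fst y) \<and> f \<cdot>\<^bsub>D\<^esub> snd x = snd y \<cdot>\<^bsub>D\<^esub> amap T f},
      Dom = (\<lambda>(x, f, y). x),
      Cod = (\<lambda>(x, f, y). y),
      Ide = (\<lambda>x. (x, Ide D (fst x), x)),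
      Comp = (\<lambda>(y, g, z) (x, f, y'). (x, g \<cdot>\<^bsub>D\<^esub> f, z))\<rparr>"

definition adj_em_category ::
  "('p, 'n) category \<Rightarrow> ('p, 'n, 'o, 'm) cfunctor \<Rightarrow> ('o, 'm, 'p, 'n) cfunctor
     \<Rightarrow> ('p \<Rightarrow> 'n) \<Rightarrow> ('o \<Rightarrow> 'm) \<Rightarrow> ('p \<times> 'n, ('p \<times> 'n) \<times> 'n \<times> ('p \<times> 'n)) category" where
  "adj_em_category D L G \<eta> \<epsilon> =
     em_category D (comp_functor G L) \<eta> (\<lambda>d. amap G (\<epsilon> (omap L d)))"

definition comparison_functor ::
  "('o, 'm) category \<Rightarrow> ('o, 'm, 'p, 'n) cfunctor \<Rightarrow> ('o \<Rightarrow> 'm)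
     \<Rightarrow> ('o, 'm, 'p \<times> 'n, ('p \<times> 'n) \<times> 'n \<times> ('p \<times> 'n)) cfunctor" where
  "comparison_functor C G \<epsilon> =
     \<lparr>omap = (\<lambda>c. (omap G c, amap G (\<epsilon> c))),
      amap = (\<lambda>f. ((omap G (Dom C f), amap G (\<epsilon> (Dom C f))), amap G f,
                    (omap G (Cod C f), amap G (\<epsilon> (Cod C f)))))\<rparr>"

definition is_monadic ::
  "('o, 'm) category \<Rightarrow> ('p, 'n) category \<Rightarrow> ('o, 'm, 'p, 'n) cfunctor \<Rightarrow> bool" where
  "is_monadic C D G \<longleftrightarrow>
     (\<exists>L \<eta> \<epsilon>. is_adjunction C D L G \<eta> \<epsilon> \<and>
        is_equivalence C (adj_em_category D L G \<eta> \<epsilon>) (comparison_functor C G \<epsilon>))"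


section \<open>Limits and regular categories\<close>

definition is_cone ::
  "('i, 'j) category \<Rightarrow> ('o, 'm) category \<Rightarrow> ('i, 'j, 'o, 'm) cfunctor \<Rightarrow> 'o \<Rightarrow> ('i \<Rightarrow> 'm) \<Rightarrow> bool" where
  "is_cone J C D x \<xi> \<longleftrightarrow> x \<in> Obj C \<and>
     (\<forall>i\<in>Obj J. \<xi> i \<in> hom C x (omap D i)) \<and>
     (\<forall>u\<in>Arr J. amap D u \<cdot>\<^bsub>C\<^esub> \<xi> (Dom J u) = \<xi> (Cod J u))"

definition is_limit ::
  "('i, 'j) category \<Rightarrow> ('o, 'm) category \<Rightarrow> ('i, 'j, 'o, 'm) cfunctor \<Rightarrow> 'o \<Rightarrow> ('i \<Rightarrow> 'm) \<Rightarrow> bool" where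
  "is_limit J C D l \<pi> \<longleftrightarrow> is_cone J C D l \<pi> \<and>
     (\<forall>x \<xi>. is_cone J C D x \<xi> \<longrightarrow>
        (\<exists>!h. h \<in> hom C x l \<and> (\<forall>i\<in>Obj J. \<pi> i \<cdot>\<^bsub>C\<^esub> h = \<xi> i)))"

text \<open>Every finite category is isomorphic to one whose objects and arrows are natural numbers, so
  restricting the index categories to these loses nothing.\<close>

definition finitely_complete :: "('o, 'm) category \<Rightarrow> bool" where
  "finitely_complete C \<longleftrightarrow> is_category C \<and>
     (\<forall>(J :: (nat, nat) category) D.
        finite (Obj J) \<longrightarrow> finite (Arr J) \<longrightarrow> is_functor J C D \<longrightarrow> (\<exists>l \<pi>. is_limit J C D l \<pi>))"

text \<open>\<open>is_pullback C p q f g\<close>: the commutative square \<open>f \<cdot> p = g \<cdot> q\<close> is a pullback.\<close>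

definition is_pullback :: "('o, 'm) category \<Rightarrow> 'm \<Rightarrow> 'm \<Rightarrow> 'm \<Rightarrow> 'm \<Rightarrow> bool" where
  "is_pullback C p q f g \<longleftrightarrow>
     p \<in> Arr C \<and> q \<in> Arr C \<and> f \<in> Arr C \<and> g \<in> Arr C \<and>
     Dom C p = Dom C q \<and> Cod C p = Dom C f \<and> Cod C q = Dom C g \<and> Cod C f = Cod C g \<and>
     f \<cdot>\<^bsub>C\<^esub> p = g \<cdot>\<^bsub>C\<^esub> q \<and>
     (\<forall>x y. x \<in> Arr C \<longrightarrow> y \<in> Arr C \<longrightarrow> Dom C x = Dom C y \<longrightarrow>
        Cod C x = Dom C f \<longrightarrow> Cod C y = Dom C g \<longrightarrow> f \<cdot>\<^bsub>C\<^esub> x = g \<cdot>\<^bsub>C\<^esub> y \<longrightarrow>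
        (\<exists>!u. u \<in> hom C (Dom C x) (Dom C p) \<and> p \<cdot>\<^bsub>C\<^esub> u = x \<and> q \<cdot>\<^bsub>C\<^esub> u = y))"

definition is_coequaliser :: "('o, 'm) category \<Rightarrow> 'm \<Rightarrow> 'm \<Rightarrow> 'm \<Rightarrow> bool" where
  "is_coequaliser C e u v \<longleftrightarrow>
     e \<in> Arr C \<and> u \<in> Arr C \<and> v \<in> Arr C \<and>
     Dom C u = Dom C v \<and> Cod C u = Dom C e \<and> Cod C v = Dom C e \<and>
     e \<cdot>\<^bsub>C\<^esub> u = e \<cdot>\<^bsub>C\<^esub> v \<and>
     (\<forall>h\<in>Arr C. Dom C h = Dom C e \<longrightarrow> h \<cdot>\<^bsub>C\<^esub> u = h \<cdot>\<^bsub>C\<^esub> v \<longrightarrow>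
        (\<exists>!w. w \<in> hom C (Cod C e) (Cod C h) \<and> w \<cdot>\<^bsub>C\<^esub> e = h))"

definition is_regular_epi :: "('o, 'm) category \<Rightarrow> 'm \<Rightarrow> bool" where
  "is_regular_epi C e \<longleftrightarrow> (\<exists>u v. is_coequaliser C e u v)"

definition is_factorisation :: "('o, 'm) category \<Rightarrow> 'm \<Rightarrow> 'm \<Rightarrow> 'm \<Rightarrow> bool" where
  "is_factorisation C f e m \<longleftrightarrow>
     is_regular_epi C e \<and> is_mono C m \<and> Cod C e = Dom C m \<and> f = m \<cdot>\<^bsub>C\<^esub> e"

text \<open>Stability: pulling back a factorisation \<open>f = m \<cdot> e\<close> along an arrow \<open>g\<close> into \<open>Cod f\<close> is done
  in two steps, first \<open>m\<close> along \<open>g\<close>, then \<open>e\<close> along the resulting projection \<open>a\<close>; the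
  composite \<open>m' \<cdot> e'\<close> is the pullback of \<open>f\<close> along \<open>g\<close>.\<close>

definition is_regular :: "('o, 'm) category \<Rightarrow> bool" where
  "is_regular C \<longleftrightarrow> finitely_complete C \<and>
     (\<forall>f\<in>Arr C. \<exists>e m. is_factorisation C f e m) \<and>
     (\<forall>f e m g a m' b e'. is_factorisation C f e m \<longrightarrow>
        is_pullback C a m' m g \<longrightarrow> is_pullback C b e' e a \<longrightarrow>
        is_factorisation C (m' \<cdot>\<^bsub>C\<^esub> e') e' m')"


section \<open>Pointed, protomodular and homological categories\<close>

definition is_zero_obj :: "('o, 'm) category \<Rightarrow> 'o \<Rightarrow> bool" where
  "is_zero_obj C z \<longleftrightarrow> z \<in> Obj C \<and>
     (\<forall>a\<in>Obj C. (\<exists>!f. f \<in> hom C a z) \<and> (\<exists>!f. f \<in> hom C z a))"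

definition is_pointed :: "('o, 'm) category \<Rightarrow> bool" where
  "is_pointed C \<longleftrightarrow> is_category C \<and> (\<exists>z. is_zero_obj C z)"

definition zero_arr :: "('o, 'm) category \<Rightarrow> 'o \<Rightarrow> 'o \<Rightarrow> 'm" where
  "zero_arr C a b =
     (THE f. \<exists>z g h. is_zero_obj C z \<and> g \<in> hom C a z \<and> h \<in> hom C z b \<and> f = h \<cdot>\<^bsub>C\<^esub> g)"

definition is_kernel :: "('o, 'm) category \<Rightarrow> 'm \<Rightarrow> 'm \<Rightarrow> bool" where
  "is_kernel C k f \<longleftrightarrow>
     k \<in> Arr C \<and> f \<in> Arr C \<and> Cod C k = Dom C f \<and>
     f \<cdot>\<^bsub>C\<^esub> k = zero_arr C (Dom C k) (Cod C f) \<and>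
     (\<forall>h\<in>Arr C. Cod C h = Dom C f \<longrightarrow> f \<cdot>\<^bsub>C\<^esub> h = zero_arr C (Dom C h) (Cod C f) \<longrightarrow>
        (\<exists>!u. u \<in> hom C (Dom C h) (Dom C k) \<and> k \<cdot>\<^bsub>C\<^esub> u = h))"

definition is_cokernel :: "('o, 'm) category \<Rightarrow> 'm \<Rightarrow> 'm \<Rightarrow> bool" where
  "is_cokernel C q f \<longleftrightarrow>
     q \<in> Arr C \<and> f \<in> Arr C \<and> Dom C q = Cod C f \<and>
     q \<cdot>\<^bsub>C\<^esub> f = zero_arr C (Dom C f) (Cod C q) \<and>
     (\<forall>h\<in>Arr C. Dom C h = Cod C f \<longrightarrow> h \<cdot>\<^bsub>C\<^esub> f = zero_arr C (Dom C f) (Cod C h) \<longrightarrow>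
        (\<exists>!u. u \<in> hom C (Cod C q) (Cod C h) \<and> u \<cdot>\<^bsub>C\<^esub> q = h))"

text \<open>The object \<open>K[f]\<close>, for a chosen kernel of \<open>f\<close>.\<close>

definition ker_obj :: "('o, 'm) category \<Rightarrow> 'm \<Rightarrow> 'o" where
  "ker_obj C f = Dom C (SOME k. is_kernel C k f)"

definition short_exact :: "('o, 'm) category \<Rightarrow> 'm \<Rightarrow> 'm \<Rightarrow> bool" where
  "short_exact C k f \<longleftrightarrow> is_kernel C k f \<and> is_cokernel C f k"

definition split_short_exact :: "('o, 'm) category \<Rightarrow> 'm \<Rightarrow> 'm \<Rightarrow> 'm \<Rightarrow> bool" where
  "split_short_exact C k f s \<longleftrightarrow>
     is_kernel C k f \<and> s \<in> hom C (Cod C f) (Dom C f) \<and> f \<cdot>\<^bsub>C\<^esub> s = Ide C (Cod C f)"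

definition split_short_five :: "('o, 'm) category \<Rightarrow> bool" where
  "split_short_five C \<longleftrightarrow>
     (\<forall>k f s k' f' s' u v w.
        split_short_exact C k f s \<longrightarrow> split_short_exact C k' f' s' \<longrightarrow>
        u \<in> hom C (Dom C k) (Dom C k') \<longrightarrow> v \<in> hom C (Dom C f) (Dom C f') \<longrightarrow>
        w \<in> hom C (Cod C f) (Cod C f') \<longrightarrow>
        v \<cdot>\<^bsub>C\<^esub> k = k' \<cdot>\<^bsub>C\<^esub> u \<longrightarrow> f' \<cdot>\<^bsub>C\<^esub> v = w \<cdot>\<^bsub>C\<^esub> f \<longrightarrow> v \<cdot>\<^bsub>C\<^esub> s = s' \<cdot>\<^bsub>C\<^esub> w \<longrightarrow>
        is_iso C u \<longrightarrow> is_iso C w \<longrightarrow> is_iso C v)"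

definition is_protomodular :: "('o, 'm) category \<Rightarrow> bool" where
  "is_protomodular C \<longleftrightarrow> is_pointed C \<and>
     (\<forall>f g. is_split_epi C f \<longrightarrow> g \<in> Arr C \<longrightarrow> Cod C g = Cod C f \<longrightarrow>
        (\<exists>p q. is_pullback C p q f g)) \<and>
     split_short_five C"

definition is_homological :: "('o, 'm) category \<Rightarrow> bool" where
  "is_homological C \<longleftrightarrow> is_pointed C \<and> is_protomodular C \<and> is_regular C"

definition is_protoadditive ::
  "('o, 'm) category \<Rightarrow> ('p, 'n) category \<Rightarrow> ('o, 'm, 'p, 'n) cfunctor \<Rightarrow> bool" where
  "is_protoadditive C D F \<longleftrightarrow> is_functor C D F \<and>
     (\<forall>k f s. split_short_exact C k f s \<longrightarrow> split_short_exact D (amap F k) (amap F f) (amap F s))"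


section \<open>Torsion theories and reflections\<close>

definition is_torsion_theory :: "('o, 'm) category \<Rightarrow> 'o set \<Rightarrow> 'o set \<Rightarrow> bool" where
  "is_torsion_theory C \<T> \<F> \<longleftrightarrow>
     \<T> \<subseteq> Obj C \<and> \<F> \<subseteq> Obj C \<and> replete C \<T> \<and> replete C \<F> \<and>
     (\<forall>t\<in>\<T>. \<forall>x\<in>\<F>. hom C t x = {zero_arr C t x}) \<and>
     (\<forall>a\<in>Obj C. \<exists>k q. short_exact C k q \<and> Dom C q = a \<and> Dom C k \<in> \<T> \<and> Cod C q \<in> \<F>)"

text \<open>\<open>F\<close> is a reflector onto the full subcategory on \<open>\<F>\<close>, with unit \<open>\<eta>\<close>. In \<open>is_nat_trans\<close> the
  same \<open>F\<close> is read as an endofunctor of \<open>C\<close>, i.e. composed with the inclusion. For the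
  torsion-free part of a torsion theory the cokernel parts of the short exact sequences
  \<open>0 \<rightarrow> T \<rightarrow> A \<rightarrow> F(A) \<rightarrow> 0\<close> have this universal property, and a reflection is unique up to
  isomorphism.\<close>

definition is_reflection ::
  "('o, 'm) category \<Rightarrow> 'o set \<Rightarrow> ('o, 'm, 'o, 'm) cfunctor \<Rightarrow> ('o \<Rightarrow> 'm) \<Rightarrow> bool" where
  "is_reflection C \<F> F \<eta> \<longleftrightarrow>
     is_functor C (full_subcat C \<F>) F \<and>
     is_nat_trans C C id_functor F \<eta> \<and>
     (\<forall>a\<in>Obj C. \<forall>x\<in>\<F>. \<forall>f\<in>hom C a x. \<exists>!g. g \<in> hom C (omap F a) x \<and> g \<cdot>\<^bsub>C\<^esub> \<eta> a = f)"


section \<open>Effective descent\<close>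

text \<open>The slice category \<open>C \<down> b\<close>: its objects are the arrows into \<open>b\<close>; an arrow from \<open>f\<close> to \<open>g\<close>
  is a triple \<open>(f, h, g)\<close> with \<open>g \<cdot> h = f\<close>.\<close>

definition slice :: "('o, 'm) category \<Rightarrow> 'o \<Rightarrow> ('m, 'm \<times> 'm \<times> 'm) category" where
  "slice C b =
     \<lparr>Obj = {f \<in> Arr C. Cod C f = b},
      Arr = {(f, h, g). f \<in> Arr C \<and> g \<in> Arr C \<and> Cod C f = b \<and> Cod C g = b \<and>
               h \<in> hom C (Dom C f) (Dom C g) \<and> g \<cdot>\<^bsub>C\<^esub> h = f},
      Dom = (\<lambda>(f, h, g). f),
      Cod = (\<lambda>(f, h, g). g),
      Ide = (\<lambda>f. (f, Ide C (Dom C f), f)),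
      Comp = (\<lambda>(g, k, l) (f, h, g'). (f, k \<cdot>\<^bsub>C\<^esub> h, l))\<rparr>"

text \<open>A chosen pullback of \<open>f\<close> along \<open>p\<close>; \<open>pb_along C p f\<close> is the projection \<open>p\<^sup>*(f)\<close> onto the
  domain of \<open>p\<close>, and \<open>pb_proj C p f\<close> is the projection onto the domain of \<open>f\<close>.\<close>

definition chosen_pb :: "('o, 'm) category \<Rightarrow> 'm \<Rightarrow> 'm \<Rightarrow> 'm \<times> 'm" where
  "chosen_pb C p f = (SOME r. is_pullback C (fst r) (snd r) p f)"

definition pb_along :: "('o, 'm) category \<Rightarrow> 'm \<Rightarrow> 'm \<Rightarrow> 'm" where
  "pb_along C p f = fst (chosen_pb C p f)"

definition pb_proj :: "('o, 'm) category \<Rightarrow> 'm \<Rightarrow> 'm \<Rightarrow> 'm" where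
  "pb_proj C p f = snd (chosen_pb C p f)"

definition pullback_functor ::
  "('o, 'm) category \<Rightarrow> 'm \<Rightarrow> ('m, 'm \<times> 'm \<times> 'm, 'm, 'm \<times> 'm \<times> 'm) cfunctor" where
  "pullback_functor C p =
     \<lparr>omap = pb_along C p,
      amap = (\<lambda>(f, h, g).
        (pb_along C p f,
         THE u. u \<in> hom C (Dom C (pb_along C p f)) (Dom C (pb_along C p g)) \<and>
           pb_along C p g \<cdot>\<^bsub>C\<^esub> u = pb_along C p f \<and>
           pb_proj C p g \<cdot>\<^bsub>C\<^esub> u = h \<cdot>\<^bsub>C\<^esub> pb_proj C p f,
         pb_along C p g))\<rparr>"

definition effective_descent :: "('o, 'm) category \<Rightarrow> 'm \<Rightarrow> bool" where
  "effective_descent C p \<longleftrightarrow> p \<in> Arr C \<and>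
     is_monadic (slice C (Cod C p)) (slice C (Dom C p)) (pullback_functor C p)"


section \<open>Extensions with respect to the absolute Galois structure of a reflection\<close>

definition trivial_extension ::
  "('o, 'm) category \<Rightarrow> ('o, 'm, 'o, 'm) cfunctor \<Rightarrow> ('o \<Rightarrow> 'm) \<Rightarrow> 'm \<Rightarrow> bool" where
  "trivial_extension C F \<eta> f \<longleftrightarrow>
     f \<in> Arr C \<and> is_pullback C (\<eta> (Dom C f)) f (amap F f) (\<eta> (Cod C f))"

definition central_extension ::
  "('o, 'm) category \<Rightarrow> ('o, 'm, 'o, 'm) cfunctor \<Rightarrow> ('o \<Rightarrow> 'm) \<Rightarrow> 'm \<Rightarrow> bool" where
  "central_extension C F \<eta> f \<longleftrightarrow> f \<in> Arr C \<and>
     (\<exists>p. effective_descent C p \<and> Cod C p = Cod C f \<and> trivial_extension C F \<eta> (pb_along C p f))"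

definition normal_extension ::
  "('o, 'm) category \<Rightarrow> ('o, 'm, 'o, 'm) cfunctor \<Rightarrow> ('o \<Rightarrow> 'm) \<Rightarrow> 'm \<Rightarrow> bool" where
  "normal_extension C F \<eta> f \<longleftrightarrow>
     effective_descent C f \<and> trivial_extension C F \<eta> (pb_along C f f)"

end

theory Submission
  imports Defs
begin

text \<open>Kernels are invariant under pullback, so a central extension has the same kernel as a trivial one, which is
  a kernel of an arrow between torsion-free objects and hence torsion-free. Conversely, if the kernel
  \<open>K\<close> of \<open>f\<close> is torsion-free, then a kernel pair projection of \<open>f\<close> is a split epimorphism with
  kernel \<open>K\<close>; the reflector preserves this split short exact sequence, and the split short five lemma
  identifies its domain with the pullback of its reflection along the unit, because \<open>\<eta>\<close> is
  invertible at \<open>K\<close>.\<close>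

section \<open>Hom-set calculus, isomorphisms and pullback squares\<close>

locale category_locale =
  fixes C :: "('o, 'm) category" (structure)
  assumes category: "is_category C"
begin

lemma arr_hom: "f \<in> Arr C \<Longrightarrow> f \<in> hom C (Dom C f) (Cod C f)"
  by (simp add: hom_def)

lemma hom_obj: "f \<in> hom C a b \<Longrightarrow> a \<in> Obj C \<and> b \<in> Obj C"
  using category unfolding is_category_def hom_def by auto

lemma ide_hom [simp]: "a \<in> Obj C \<Longrightarrow> Ide C a \<in> hom C a a"
  using category unfolding is_category_def by blast

lemma comp_hom [intro]: "f \<in> hom C a b \<Longrightarrow> g \<in> hom C b c \<Longrightarrow> g \<cdot> f \<in> hom C a c"
  using category unfolding is_category_def hom_def by auto

lemma comp_assoc:
  "f \<in> hom C a b \<Longrightarrow> g \<in> hom C b c \<Longrightarrow> h \<in> hom C c d \<Longrightarrow> (h \<cdot> g) \<cdot> f = h \<cdot> (g \<cdot> f)"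
  using category unfolding is_category_def hom_def by auto

lemma comp_ide: "f \<in> hom C a b \<Longrightarrow> f \<cdot> Ide C a = f"
  and ide_comp: "f \<in> hom C a b \<Longrightarrow> Ide C b \<cdot> f = f"
  using category unfolding is_category_def hom_def by auto

lemma is_isoI:
  assumes "f \<in> hom C a b" "g \<in> hom C b a" "g \<cdot> f = Ide C a" "f \<cdot> g = Ide C b"
  shows "is_iso C f"
  using assms unfolding is_iso_def hom_def by auto

lemma is_isoE:
  assumes "is_iso C f" "f \<in> hom C a b"
  obtains g where "g \<in> hom C b a" "g \<cdot> f = Ide C a" "f \<cdot> g = Ide C b"
  using assms unfolding is_iso_def hom_def by auto

text \<open>The definition quantifies over arrows constrained by \<open>Dom\<close> and
  \<open>Cod\<close>; this rule and the destruction rule after it restate it with hom-sets, so that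
  typing facts can be chained with \<open>comp_hom\<close> and \<open>comp_assoc\<close>.\<close>

lemma is_pullbackI:
  assumes h: "p \<in> hom C P A" "q \<in> hom C P B" "f \<in> hom C A D" "g \<in> hom C B D" "f \<cdot> p = g \<cdot> q"
    and univ: "\<And>X x y. x \<in> hom C X A \<Longrightarrow> y \<in> hom C X B \<Longrightarrow> f \<cdot> x = g \<cdot> y \<Longrightarrow>
      \<exists>!u. u \<in> hom C X P \<and> p \<cdot> u = x \<and> q \<cdot> u = y"
  shows "is_pullback C p q f g"
proof -
  have "\<exists>!u. u \<in> hom C (Dom C x) (Dom C p) \<and> p \<cdot> u = x \<and> q \<cdot> u = y"
    if "x \<in> Arr C" "y \<in> Arr C" "Dom C x = Dom C y" "Cod C x = Dom C f" "Cod C y = Dom C g"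
      "f \<cdot> x = g \<cdot> y" for x y
  proof -
    have "x \<in> hom C (Dom C x) A" "y \<in> hom C (Dom C x) B" "Dom C p = P"
      using that h by (simp_all add: hom_def)
    then show ?thesis using univ that(6) by simp
  qed
  then show ?thesis using h unfolding is_pullback_def by (simp add: hom_def)
qed

lemma is_pullbackD:
  assumes pb: "is_pullback C p q f g" and h: "p \<in> hom C P A" "f \<in> hom C A D" "g \<in> hom C B D"
  shows "q \<in> hom C P B" "f \<cdot> p = g \<cdot> q"
    and "x \<in> hom C X A \<Longrightarrow> y \<in> hom C X B \<Longrightarrow> f \<cdot> x = g \<cdot> y \<Longrightarrow>
      \<exists>!u. u \<in> hom C X P \<and> p \<cdot> u = x \<and> q \<cdot> u = y"
proof -
  show "q \<in> hom C P B" "f \<cdot> p = g \<cdot> q"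
    using pb h unfolding is_pullback_def by (simp_all add: hom_def)
  assume xy: "x \<in> hom C X A" "y \<in> hom C X B" "f \<cdot> x = g \<cdot> y"
  have univ: "\<forall>x y. x \<in> Arr C \<longrightarrow> y \<in> Arr C \<longrightarrow> Dom C x = Dom C y \<longrightarrow>
      Cod C x = Dom C f \<longrightarrow> Cod C y = Dom C g \<longrightarrow> f \<cdot> x = g \<cdot> y \<longrightarrow>
      (\<exists>!u. u \<in> hom C (Dom C x) (Dom C p) \<and> p \<cdot> u = x \<and> q \<cdot> u = y)"
    using pb unfolding is_pullback_def by (elim conjE)
  show "\<exists>!u. u \<in> hom C X P \<and> p \<cdot> u = x \<and> q \<cdot> u = y"
    using univ[rule_format, of x y] xy h by (simp add: hom_def)
qed

text \<open>The projections of a pullback are jointly monic: both \<open>u\<close> and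
  \<open>v\<close> solve the universal problem posed by the pair \<open>p \<cdot> u\<close>,
  \<open>q \<cdot> u\<close>, and its solution is unique.\<close>

lemma is_pullback_ext:
  assumes pb: "is_pullback C p q f g"
    and h: "p \<in> hom C P A" "f \<in> hom C A D" "g \<in> hom C B D"
    and uv: "u \<in> hom C X P" "v \<in> hom C X P" "p \<cdot> u = p \<cdot> v" "q \<cdot> u = q \<cdot> v"
  shows "u = v"
proof -
  note q = is_pullbackD(1,2)[OF pb h]
  have "f \<cdot> (p \<cdot> u) = g \<cdot> (q \<cdot> u)"
    using comp_assoc[OF uv(1) h(1,2)] comp_assoc[OF uv(1) q(1) h(3)] q(2) by simp
  then show ?thesis
    using is_pullbackD(3)[OF pb h comp_hom[OF uv(1) h(1)] comp_hom[OF uv(1) q(1)]] uv by metis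
qed

lemma is_pullback_sym:
  assumes pb: "is_pullback C p q f g" shows "is_pullback C q p g f"
proof -
  define P A B D where "P = Dom C p" and "A = Dom C f" and "B = Dom C g" and "D = Cod C f"
  have h: "p \<in> hom C P A" "f \<in> hom C A D" "g \<in> hom C B D"
    using pb unfolding is_pullback_def P_def A_def B_def D_def by (simp_all add: hom_def)
  note q = is_pullbackD(1,2)[OF pb h]
  show ?thesis
  proof (rule is_pullbackI[OF q(1) h(1,3,2) q(2)[symmetric]])
    fix X x y assume "x \<in> hom C X B" "y \<in> hom C X A" "g \<cdot> x = f \<cdot> y"
    then show "\<exists>!u. u \<in> hom C X P \<and> q \<cdot> u = x \<and> p \<cdot> u = y"
      using is_pullbackD(3)[OF pb h, of y X x] by (simp add: conj_commute)
  qed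
qed

text \<open>Factorisations through \<open>P\<close> correspond to factorisations through
  \<open>R\<close> by composing with \<open>v\<close> and its inverse \<open>w\<close>. This later
  turns an invertible comparison arrow into the statement that the naturality square of the unit is
  a pullback.\<close>

lemma is_pullback_iso_comp:
  assumes pb: "is_pullback C p q f g"
    and h: "p \<in> hom C P A" "f \<in> hom C A D" "g \<in> hom C B D"
    and v: "v \<in> hom C R P" "is_iso C v"
  shows "is_pullback C (p \<cdot> v) (q \<cdot> v) f g"
proof -
  note q = is_pullbackD(1,2)[OF pb h]
  obtain w where w: "w \<in> hom C P R" "w \<cdot> v = Ide C R" "v \<cdot> w = Ide C P"
    using is_isoE[OF v(2,1)] .
  show ?thesis
  proof (rule is_pullbackI[OF comp_hom[OF v(1) h(1)] comp_hom[OF v(1) q(1)] h(2,3)])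
    show "f \<cdot> (p \<cdot> v) = g \<cdot> (q \<cdot> v)"
      using comp_assoc[OF v(1) h(1,2)] comp_assoc[OF v(1) q(1) h(3)] q(2) by simp
  next
    fix X x y assume xy: "x \<in> hom C X A" "y \<in> hom C X B" "f \<cdot> x = g \<cdot> y"
    obtain u where u: "u \<in> hom C X P" "p \<cdot> u = x" "q \<cdot> u = y"
      using is_pullbackD(3)[OF pb h xy] by blast
    show "\<exists>!u. u \<in> hom C X R \<and> (p \<cdot> v) \<cdot> u = x \<and> (q \<cdot> v) \<cdot> u = y"
    proof (rule ex1I)
      have "v \<cdot> (w \<cdot> u) = u"
        using comp_assoc[OF u(1) w(1) v(1)] w(3) ide_comp[OF u(1)] by simp
      then show "w \<cdot> u \<in> hom C X R \<and> (p \<cdot> v) \<cdot> (w \<cdot> u) = x \<and> (q \<cdot> v) \<cdot> (w \<cdot> u) = y"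
        using comp_hom[OF u(1) w(1)] comp_assoc[OF _ v(1)] h(1) q(1) u by metis
    next
      fix u' assume u': "u' \<in> hom C X R \<and> (p \<cdot> v) \<cdot> u' = x \<and> (q \<cdot> v) \<cdot> u' = y"
      then have m: "u' \<in> hom C X R" by simp
      have "v \<cdot> u' = u"
        by (rule is_pullback_ext[OF pb h comp_hom[OF m v(1)] u(1)])
          (use comp_assoc[OF m v(1) h(1)] comp_assoc[OF m v(1) q(1)] u u' in simp_all)
      then show "u' = w \<cdot> u"
        using comp_assoc[OF m v(1) w(1)] w(2) ide_comp[OF m] by simp
    qed
  qed
qed

end

text \<open>The shape \<open>0 \<rightarrow> 2 \<leftarrow> 1\<close>: the arrows 0, 1, 2 are
  identities, 3 goes from 0 to 2 and 4 from 1 to 2. In a composable pair at least one factor is an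
  identity, so \<open>Comp\<close> returns \<open>u\<close> when \<open>v\<close> is an identity and
  \<open>v\<close> otherwise. Numbers serve as objects and arrows because
  \<open>finitely_complete\<close> ranges over index categories on \<open>nat\<close>.\<close>

definition cospan_shape :: "(nat, nat) category" where
  "cospan_shape = \<lparr>Obj = {0, 1, 2}, Arr = {0, 1, 2, 3, 4},
     Dom = (\<lambda>u. if u = 3 then 0 else if u = 4 then 1 else u),
     Cod = (\<lambda>u. if u = 3 \<or> u = 4 then 2 else u),
     Ide = (\<lambda>i. i),
     Comp = (\<lambda>v u. if v \<le> 2 then u else v)\<rparr>"

lemma is_category_cospan_shape: "is_category cospan_shape"
  unfolding is_category_def hom_def cospan_shape_def by auto

lemma (in category_locale) finitely_complete_pullback:
  assumes fc: "finitely_complete C" and f: "f \<in> hom C A D" and g: "g \<in> hom C B D"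
  shows "\<exists>p q. is_pullback C p q f g"
proof -
  let ?o = "\<lambda>i::nat. if i = 0 then A else if i = 1 then B else D"
  let ?G = "\<lparr>omap = ?o, amap = (\<lambda>u. if u = 3 then f else if u = 4 then g else Ide C (?o u))\<rparr>"
  have ob: "A \<in> Obj C" "B \<in> Obj C" "D \<in> Obj C" using hom_obj f g by auto
  have "is_functor cospan_shape C ?G"
    unfolding is_functor_def using is_category_cospan_shape category
    by (auto simp: cospan_shape_def ob f g comp_ide[OF f] comp_ide[OF g] ide_comp[OF f]
        ide_comp[OF g] comp_ide[OF ide_hom] split: if_splits)
  moreover have "finite (Obj cospan_shape)" "finite (Arr cospan_shape)"
    by (simp_all add: cospan_shape_def)
  ultimately obtain l \<pi> where lim: "is_limit cospan_shape C ?G l \<pi>"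
    using fc unfolding finitely_complete_def by blast
  \<comment> \<open>The component at the vertex 2 is forced to be the common composite, so a cone
    amounts to a commutative square on \<open>f\<close> and \<open>g\<close>.\<close>
  have cone_iff: "is_cone cospan_shape C ?G X \<xi> \<longleftrightarrow>
      X \<in> Obj C \<and> \<xi> 0 \<in> hom C X A \<and> \<xi> 1 \<in> hom C X B \<and> \<xi> 2 \<in> hom C X D \<and>
      f \<cdot> \<xi> 0 = \<xi> 2 \<and> g \<cdot> \<xi> 1 = \<xi> 2" for X \<xi>
    unfolding is_cone_def by (auto simp: cospan_shape_def ide_comp)
  have l: "\<pi> 0 \<in> hom C l A" "\<pi> 1 \<in> hom C l B" "f \<cdot> \<pi> 0 = \<pi> 2" "g \<cdot> \<pi> 1 = \<pi> 2"
    using lim unfolding is_limit_def cone_iff by auto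
  have "is_pullback C (\<pi> 0) (\<pi> 1) f g"
  proof (rule is_pullbackI[OF l(1,2) f g])
    show "f \<cdot> \<pi> 0 = g \<cdot> \<pi> 1" using l by simp
  next
    fix X x y assume xy: "x \<in> hom C X A" "y \<in> hom C X B" "f \<cdot> x = g \<cdot> y"
    let ?\<xi> = "\<lambda>i::nat. if i = 0 then x else if i = 1 then y else f \<cdot> x"
    have "is_cone cospan_shape C ?G X ?\<xi>"
      unfolding cone_iff using xy hom_obj comp_hom[OF xy(1) f] by auto
    then have ex: "\<exists>!h. h \<in> hom C X l \<and> (\<forall>i\<in>Obj cospan_shape. \<pi> i \<cdot> h = ?\<xi> i)"
      using lim unfolding is_limit_def by blast
    \<comment> \<open>The condition at 2 follows from the one at 0 by composing with
      \<open>f\<close>.\<close>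
    have "(\<forall>i\<in>Obj cospan_shape. \<pi> i \<cdot> h = ?\<xi> i) \<longleftrightarrow> \<pi> 0 \<cdot> h = x \<and> \<pi> 1 \<cdot> h = y"
      if "h \<in> hom C X l" for h
      using comp_assoc[OF that l(1) f] l(3) by (auto simp: cospan_shape_def)
    then show "\<exists>!u. u \<in> hom C X l \<and> \<pi> 0 \<cdot> u = x \<and> \<pi> 1 \<cdot> u = y"
      using ex by (metis (no_types, lifting))
  qed
  then show ?thesis by blast
qed

lemma is_pullback_chosen:
  assumes "\<exists>a b. is_pullback C a b p f"
  shows "is_pullback C (pb_along C p f) (pb_proj C p f) p f"
  using someI_ex[of "\<lambda>r. is_pullback C (fst r) (snd r) p f"] assms
  unfolding pb_along_def pb_proj_def chosen_pb_def by simp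

section \<open>Zero arrows and kernels in a pointed category\<close>

locale pointed_category = category_locale +
  assumes pointed: "is_pointed C"
begin

lemma zero_obj_mem_Obj: "is_zero_obj C z \<Longrightarrow> z \<in> Obj C"
  unfolding is_zero_obj_def by (elim conjE)

lemma to_zero_obj:
  assumes "is_zero_obj C z" "a \<in> Obj C"
  obtains g where "g \<in> hom C a z"
  using assms unfolding is_zero_obj_def by blast

lemma from_zero_obj:
  assumes "is_zero_obj C z" "a \<in> Obj C"
  obtains h where "h \<in> hom C z a"
  using assms unfolding is_zero_obj_def by blast

lemma to_zero_obj_unique:
  assumes "is_zero_obj C z" "g \<in> hom C a z" "h \<in> hom C a z" shows "g = h"
proof -
  have "\<exists>!f. f \<in> hom C a z"
    using assms(1) hom_obj[OF assms(2)] unfolding is_zero_obj_def by simp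
  then show ?thesis using assms(2,3) by metis
qed

lemma from_zero_obj_unique:
  assumes "is_zero_obj C z" "g \<in> hom C z a" "h \<in> hom C z a" shows "g = h"
proof -
  have "\<exists>!f. f \<in> hom C z a"
    using assms(1) hom_obj[OF assms(2)] unfolding is_zero_obj_def by simp
  then show ?thesis using assms(2,3) by metis
qed

text \<open>This makes the description operator in \<open>zero_arr\<close> usable: the composite
  does not depend on the zero object, because the arrow \<open>t\<close> between two zero objects is
  compatible with all arrows into and out of them.\<close>

lemma zero_arr_eq:
  assumes z: "is_zero_obj C z" and g: "g \<in> hom C a z" and h: "h \<in> hom C z b"
  shows "zero_arr C a b = h \<cdot> g"
  unfolding zero_arr_def
proof (rule the_equality)
  show "\<exists>z g' h'. is_zero_obj C z \<and> g' \<in> hom C a z \<and> h' \<in> hom C z b \<and> h \<cdot> g = h' \<cdot> g'"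
    using assms by blast
next
  fix k assume "\<exists>z g h. is_zero_obj C z \<and> g \<in> hom C a z \<and> h \<in> hom C z b \<and> k = h \<cdot> g"
  then obtain z' g' h' where
    z': "is_zero_obj C z'" "g' \<in> hom C a z'" "h' \<in> hom C z' b" "k = h' \<cdot> g'" by blast
  obtain t where t: "t \<in> hom C z z'" by (rule to_zero_obj[OF z'(1) zero_obj_mem_Obj[OF z]])
  have "t \<cdot> g = g'" by (rule to_zero_obj_unique[OF z'(1) comp_hom[OF g t] z'(2)])
  moreover have "h' \<cdot> t = h" by (rule from_zero_obj_unique[OF z comp_hom[OF t z'(3)] h])
  ultimately show "k = h \<cdot> g" using z'(4) comp_assoc[OF g t z'(3)] by simp
qed

lemma zero_arr_factors:
  assumes "a \<in> Obj C" "b \<in> Obj C"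
  obtains z g h where "is_zero_obj C z" "g \<in> hom C a z" "h \<in> hom C z b" "zero_arr C a b = h \<cdot> g"
proof -
  obtain z where z: "is_zero_obj C z" using pointed unfolding is_pointed_def by blast
  obtain g where g: "g \<in> hom C a z" by (rule to_zero_obj[OF z assms(1)])
  obtain h where h: "h \<in> hom C z b" by (rule from_zero_obj[OF z assms(2)])
  show thesis by (rule that[OF z g h zero_arr_eq[OF z g h]])
qed

lemma zero_arr_hom:
  assumes "a \<in> Obj C" "b \<in> Obj C" shows "zero_arr C a b \<in> hom C a b"
  by (rule zero_arr_factors[OF assms]) (simp add: comp_hom)

lemma comp_zero_arr:
  assumes f: "f \<in> hom C b c" and a: "a \<in> Obj C"
  shows "f \<cdot> zero_arr C a b = zero_arr C a c"
proof -
  obtain z g h where z: "is_zero_obj C z" "g \<in> hom C a z" "h \<in> hom C z b" "zero_arr C a b = h \<cdot> g"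
    by (rule zero_arr_factors[OF a conjunct1[OF hom_obj[OF f]]])
  then show ?thesis
    using zero_arr_eq[OF z(1,2) comp_hom[OF z(3) f]] comp_assoc[OF z(2,3) f] by simp
qed

lemma zero_arr_comp:
  assumes f: "f \<in> hom C a b" and c: "c \<in> Obj C"
  shows "zero_arr C b c \<cdot> f = zero_arr C a c"
proof -
  obtain z g h where z: "is_zero_obj C z" "g \<in> hom C b z" "h \<in> hom C z c" "zero_arr C b c = h \<cdot> g"
    by (rule zero_arr_factors[OF conjunct2[OF hom_obj[OF f]] c])
  then show ?thesis
    using zero_arr_eq[OF z(1) comp_hom[OF f z(2)] z(3)] comp_assoc[OF f z(2,3)] by simp
qed

lemma is_kernelI:
  assumes "k \<in> hom C K A" "f \<in> hom C A B" "f \<cdot> k = zero_arr C K B"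
    and "\<And>X h. h \<in> hom C X A \<Longrightarrow> f \<cdot> h = zero_arr C X B \<Longrightarrow> \<exists>u. u \<in> hom C X K \<and> k \<cdot> u = h"
    and "\<And>X u v. u \<in> hom C X K \<Longrightarrow> v \<in> hom C X K \<Longrightarrow> k \<cdot> u = k \<cdot> v \<Longrightarrow> u = v"
  shows "is_kernel C k f"
proof -
  have "\<exists>!u. u \<in> hom C (Dom C h) K \<and> k \<cdot> u = h"
    if "h \<in> Arr C" "Cod C h = A" "f \<cdot> h = zero_arr C (Dom C h) B" for h
    using assms(4,5) that arr_hom[OF that(1)] by metis
  then show ?thesis using assms(1-3) unfolding is_kernel_def by (simp add: hom_def)
qed

lemma is_kernelD:
  assumes ker: "is_kernel C k f" and f: "f \<in> hom C A B"
  shows "k \<in> hom C (Dom C k) A" "f \<cdot> k = zero_arr C (Dom C k) B"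
    and "h \<in> hom C X A \<Longrightarrow> f \<cdot> h = zero_arr C X B \<Longrightarrow> \<exists>!u. u \<in> hom C X (Dom C k) \<and> k \<cdot> u = h"
proof -
  show "k \<in> hom C (Dom C k) A" "f \<cdot> k = zero_arr C (Dom C k) B"
    using ker f unfolding is_kernel_def by (simp_all add: hom_def)
  assume h: "h \<in> hom C X A" "f \<cdot> h = zero_arr C X B"
  have univ: "\<forall>h\<in>Arr C. Cod C h = Dom C f \<longrightarrow> f \<cdot> h = zero_arr C (Dom C h) (Cod C f) \<longrightarrow>
      (\<exists>!u. u \<in> hom C (Dom C h) (Dom C k) \<and> k \<cdot> u = h)"
    using ker unfolding is_kernel_def by (elim conjE)
  show "\<exists>!u. u \<in> hom C X (Dom C k) \<and> k \<cdot> u = h"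
    using univ[rule_format, of h] h f by (simp add: hom_def)
qed

lemma is_kernel_ext:
  assumes ker: "is_kernel C k f" and f: "f \<in> hom C A B"
    and uv: "u \<in> hom C X (Dom C k)" "v \<in> hom C X (Dom C k)" "k \<cdot> u = k \<cdot> v"
  shows "u = v"
proof -
  note k = is_kernelD(1,2)[OF ker f]
  have "f \<cdot> (k \<cdot> u) = zero_arr C X B"
    using comp_assoc[OF uv(1) k(1) f] zero_arr_comp[OF uv(1)] hom_obj[OF f] k(2) by simp
  then show ?thesis using is_kernelD(3)[OF ker f comp_hom[OF uv(1) k(1)]] uv by metis
qed

text \<open>The kernel of \<open>q\<close> is the arrow into \<open>P\<close> induced by
  \<open>k\<close> and the zero arrow. It has the very same domain as \<open>k\<close>, so
  membership of the kernel object in a subcategory transfers without an intervening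
  isomorphism.\<close>

lemma kernel_of_pullback:
  assumes pb: "is_pullback C p q f g"
    and h: "p \<in> hom C P A" "f \<in> hom C A D" "g \<in> hom C B D"
    and ker: "is_kernel C k f"
  obtains k' where "is_kernel C k' q" "k' \<in> hom C (Dom C k) P" "p \<cdot> k' = k"
proof -
  let ?K = "Dom C k"
  note q = is_pullbackD(1,2)[OF pb h]
  note k = is_kernelD(1,2)[OF ker h(2)]
  have ob: "?K \<in> Obj C" "B \<in> Obj C" using hom_obj k q by auto
  have "f \<cdot> k = g \<cdot> zero_arr C ?K B" using k(2) comp_zero_arr[OF h(3) ob(1)] by simp
  then obtain k' where k': "k' \<in> hom C ?K P" "p \<cdot> k' = k" "q \<cdot> k' = zero_arr C ?K B"
    using is_pullbackD(3)[OF pb h k(1) zero_arr_hom[OF ob]] by blast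
  have "is_kernel C k' q"
  proof (rule is_kernelI[OF k'(1) q(1) k'(3)])
    fix X x assume x: "x \<in> hom C X P" "q \<cdot> x = zero_arr C X B"
    have X: "X \<in> Obj C" using hom_obj[OF x(1)] by simp
    have "f \<cdot> (p \<cdot> x) = g \<cdot> (q \<cdot> x)"
      using comp_assoc[OF x(1) h(1,2)] comp_assoc[OF x(1) q(1) h(3)] q(2) by simp
    then have "f \<cdot> (p \<cdot> x) = zero_arr C X D" using x(2) comp_zero_arr[OF h(3) X] by simp
    then obtain u where u: "u \<in> hom C X ?K" "k \<cdot> u = p \<cdot> x"
      using is_kernelD(3)[OF ker h(2) comp_hom[OF x(1) h(1)]] by blast
    have "k' \<cdot> u = x"
    proof (rule is_pullback_ext[OF pb h comp_hom[OF u(1) k'(1)] x(1)])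
      show "p \<cdot> (k' \<cdot> u) = p \<cdot> x" using comp_assoc[OF u(1) k'(1) h(1)] k'(2) u(2) by simp
      show "q \<cdot> (k' \<cdot> u) = q \<cdot> x"
        using comp_assoc[OF u(1) k'(1) q(1)] k'(3) zero_arr_comp[OF u(1) ob(2)] x(2) by simp
    qed
    then show "\<exists>u. u \<in> hom C X ?K \<and> k' \<cdot> u = x" using u(1) by blast
  next
    fix X u v assume uv: "u \<in> hom C X ?K" "v \<in> hom C X ?K" "k' \<cdot> u = k' \<cdot> v"
    then have "k \<cdot> u = k \<cdot> v"
      using comp_assoc[OF _ k'(1) h(1)] k'(2) by metis
    then show "u = v" by (rule is_kernel_ext[OF ker h(2) uv(1,2)])
  qed
  then show thesis using that k' by blast
qed

text \<open>The opposite passage, from a kernel of the pulled back arrow \<open>q\<close> to one of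
  \<open>f\<close>: an arrow killed by \<open>f\<close>, paired with zero, factors through
  \<open>P\<close> and then through \<open>k\<close>.\<close>

lemma kernel_comp_pullback:
  assumes pb: "is_pullback C p q f g"
    and h: "p \<in> hom C P A" "f \<in> hom C A D" "g \<in> hom C B D"
    and ker: "is_kernel C k q"
  shows "is_kernel C (p \<cdot> k) f" "p \<cdot> k \<in> hom C (Dom C k) A"
proof -
  let ?K = "Dom C k"
  note q = is_pullbackD(1,2)[OF pb h]
  note k = is_kernelD(1,2)[OF ker q(1)]
  have ob: "?K \<in> Obj C" "B \<in> Obj C" using hom_obj k q by auto
  show pk: "p \<cdot> k \<in> hom C ?K A" using comp_hom[OF k(1) h(1)] .
  show "is_kernel C (p \<cdot> k) f"
  proof (rule is_kernelI[OF pk h(2)])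
    show "f \<cdot> (p \<cdot> k) = zero_arr C ?K D"
      using comp_assoc[OF k(1) h(1,2)] comp_assoc[OF k(1) q(1) h(3)] q(2) k(2)
        comp_zero_arr[OF h(3) ob(1)] by simp
  next
    fix X x assume x: "x \<in> hom C X A" "f \<cdot> x = zero_arr C X D"
    have X: "X \<in> Obj C" using hom_obj[OF x(1)] by simp
    have "f \<cdot> x = g \<cdot> zero_arr C X B" using x(2) comp_zero_arr[OF h(3) X] by simp
    then obtain u where u: "u \<in> hom C X P" "p \<cdot> u = x" "q \<cdot> u = zero_arr C X B"
      using is_pullbackD(3)[OF pb h x(1) zero_arr_hom[OF X ob(2)]] by blast
    then obtain v where v: "v \<in> hom C X ?K" "k \<cdot> v = u"
      using is_kernelD(3)[OF ker q(1) u(1)] by blast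
    then show "\<exists>v. v \<in> hom C X ?K \<and> (p \<cdot> k) \<cdot> v = x"
      using comp_assoc[OF v(1) k(1) h(1)] u(2) by auto
  next
    fix X u v assume uv: "u \<in> hom C X ?K" "v \<in> hom C X ?K" "(p \<cdot> k) \<cdot> u = (p \<cdot> k) \<cdot> v"
    have "k \<cdot> u = k \<cdot> v"
    proof (rule is_pullback_ext[OF pb h comp_hom[OF uv(1) k(1)] comp_hom[OF uv(2) k(1)]])
      show "p \<cdot> (k \<cdot> u) = p \<cdot> (k \<cdot> v)"
        using uv(3) comp_assoc[OF uv(1) k(1) h(1)] comp_assoc[OF uv(2) k(1) h(1)] by simp
      show "q \<cdot> (k \<cdot> u) = q \<cdot> (k \<cdot> v)"
        using comp_assoc[OF uv(1) k(1) q(1)] comp_assoc[OF uv(2) k(1) q(1)] k(2)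
          zero_arr_comp[OF uv(1) ob(2)] zero_arr_comp[OF uv(2) ob(2)] by simp
    qed
    then show "u = v" by (rule is_kernel_ext[OF ker q(1) uv(1,2)])
  qed
qed

text \<open>The kernel is the pullback of the arrow from the zero object along \<open>f\<close>. It
  guarantees that the choice in \<open>ker_obj\<close> selects an actual kernel.\<close>

lemma kernel_exists:
  assumes fc: "finitely_complete C" and f: "f \<in> hom C A B"
  shows "\<exists>k. is_kernel C k f"
proof -
  obtain z where z: "is_zero_obj C z" using pointed unfolding is_pointed_def by blast
  obtain i where i: "i \<in> hom C z B" by (rule from_zero_obj[OF z conjunct2[OF hom_obj[OF f]]])
  obtain p q where pb: "is_pullback C p q f i"
    using finitely_complete_pullback[OF fc f i] by blast
  have hp: "p \<in> hom C (Dom C p) A" using pb f unfolding is_pullback_def hom_def by auto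
  note hq = is_pullbackD(1,2)[OF pb hp f i]
  have "is_kernel C p f"
  proof (rule is_kernelI[OF hp f])
    show "f \<cdot> p = zero_arr C (Dom C p) B" using hq(2) zero_arr_eq[OF z hq(1) i] by simp
  next
    fix X h assume x: "h \<in> hom C X A" "f \<cdot> h = zero_arr C X B"
    obtain t where t: "t \<in> hom C X z" by (rule to_zero_obj[OF z conjunct1[OF hom_obj[OF x(1)]]])
    show "\<exists>u. u \<in> hom C X (Dom C p) \<and> p \<cdot> u = h"
      using is_pullbackD(3)[OF pb hp f i x(1) t] x(2) zero_arr_eq[OF z t i] by auto
  next
    fix X u v assume uv: "u \<in> hom C X (Dom C p)" "v \<in> hom C X (Dom C p)" "p \<cdot> u = p \<cdot> v"
    show "u = v"
      by (rule is_pullback_ext[OF pb hp f i uv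
            to_zero_obj_unique[OF z comp_hom[OF uv(1) hq(1)] comp_hom[OF uv(2) hq(1)]]])
  qed
  then show ?thesis by blast
qed

end

section \<open>Replete reflective subcategories: the unit, kernels and trivial extensions\<close>

locale reflection = pointed_category +
  fixes \<F> F \<eta>
  assumes sub: "\<F> \<subseteq> Obj C" and rep: "replete C \<F>" and refl: "is_reflection C \<F> F \<eta>"
begin

abbreviation "S \<equiv> full_subcat C \<F>"

lemma hom_S: "a \<in> \<F> \<Longrightarrow> b \<in> \<F> \<Longrightarrow> hom S a b = hom C a b"
  unfolding hom_def full_subcat_def by auto

lemma in_S: "f \<in> hom S a b \<Longrightarrow> a \<in> \<F> \<and> b \<in> \<F> \<and> f \<in> hom C a b"
  unfolding hom_def full_subcat_def by auto

lemma comp_S: "g \<cdot>\<^bsub>S\<^esub> f = g \<cdot> f" and Dom_S: "Dom S = Dom C" and Cod_S: "Cod S = Cod C"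
  and Ide_S: "Ide S = Ide C" and Obj_S: "Obj S = \<F>"
  using sub unfolding full_subcat_def by auto

lemma F_obj: "a \<in> Obj C \<Longrightarrow> omap F a \<in> \<F>"
  using refl unfolding is_reflection_def is_functor_def Obj_S by blast

lemma F_hom: "f \<in> hom C a b \<Longrightarrow> amap F f \<in> hom C (omap F a) (omap F b)"
  using refl in_S unfolding is_reflection_def is_functor_def by (auto simp: hom_def)

lemma unit_hom: "a \<in> Obj C \<Longrightarrow> \<eta> a \<in> hom C a (omap F a)"
  using refl unfolding is_reflection_def is_nat_trans_def by (auto simp: id_functor_def)

lemma unit_natural: "f \<in> hom C a b \<Longrightarrow> \<eta> b \<cdot> f = amap F f \<cdot> \<eta> a"
  using refl unfolding is_reflection_def is_nat_trans_def by (auto simp: id_functor_def hom_def)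

lemma unit_universal: "f \<in> hom C a x \<Longrightarrow> x \<in> \<F> \<Longrightarrow> \<exists>!g. g \<in> hom C (omap F a) x \<and> g \<cdot> \<eta> a = f"
  using refl hom_obj unfolding is_reflection_def by blast

lemma unit_ext:
  assumes "a \<in> Obj C" "x \<in> \<F>" "g \<in> hom C (omap F a) x" "h \<in> hom C (omap F a) x" "g \<cdot> \<eta> a = h \<cdot> \<eta> a"
  shows "g = h"
  using unit_universal[OF comp_hom[OF unit_hom[OF assms(1)] assms(3)] assms(2)] assms by metis

text \<open>A one-sided inverse of the unit is two-sided: \<open>\<eta> a \<cdot> r\<close> and the
  identity agree after precomposition with \<open>\<eta> a\<close>, and both land in
  \<open>\<F>\<close>. Repleteness applied to the isomorphism \<open>r\<close> then moves membership
  from \<open>omap F a\<close> to \<open>a\<close>.\<close>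

lemma retract_unit_iso:
  assumes a: "a \<in> Obj C" and r: "r \<in> hom C (omap F a) a" "r \<cdot> \<eta> a = Ide C a"
  shows "is_iso C (\<eta> a)" "a \<in> \<F>"
proof -
  note e = unit_hom[OF a]
  note Fa = F_obj[OF a]
  have "\<eta> a \<cdot> r = Ide C (omap F a)"
  proof (rule unit_ext[OF a Fa comp_hom[OF r(1) e]])
    show "Ide C (omap F a) \<in> hom C (omap F a) (omap F a)" using Fa sub by auto
    show "(\<eta> a \<cdot> r) \<cdot> \<eta> a = Ide C (omap F a) \<cdot> \<eta> a"
      using comp_assoc[OF e r(1) e] r(2) comp_ide[OF e] ide_comp[OF e] by simp
  qed
  then show "is_iso C (\<eta> a)" using is_isoI[OF e r(1)] r(2) by blast
  have "is_iso C r" using is_isoI[OF r(1) e] r(2) \<open>\<eta> a \<cdot> r = _\<close> by blast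
  then show "a \<in> \<F>" using rep Fa r(1) unfolding replete_def hom_def by auto
qed

lemma unit_iso: assumes "a \<in> \<F>" shows "is_iso C (\<eta> a)"
proof -
  have a: "a \<in> Obj C" using assms sub by auto
  then obtain r where "r \<in> hom C (omap F a) a" "r \<cdot> \<eta> a = Ide C a"
    using unit_universal[OF ide_hom[OF a] assms] by blast
  then show ?thesis using retract_unit_iso a by blast
qed

text \<open>Any arrow from \<open>omap F z\<close> to \<open>z\<close> retracts the unit, since
  \<open>z\<close> has only one endomorphism. Hence \<open>S\<close> is pointed by the zero objects
  of \<open>C\<close>, and zero arrows and kernels can be compared between the two
  categories.\<close>

lemma zero_obj_mem: assumes z: "is_zero_obj C z" shows "z \<in> \<F>"
proof -
  note zo = zero_obj_mem_Obj[OF z]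
  obtain r where r: "r \<in> hom C (omap F z) z"
    by (rule to_zero_obj[OF z subsetD[OF sub F_obj[OF zo]]])
  have "r \<cdot> \<eta> z = Ide C z"
    by (rule to_zero_obj_unique[OF z comp_hom[OF unit_hom[OF zo] r] ide_hom[OF zo]])
  then show ?thesis using retract_unit_iso zo r by blast
qed

lemma is_category_S: "is_category S"
  using refl unfolding is_reflection_def is_functor_def by blast

lemma zero_obj_S: assumes z: "is_zero_obj C z" shows "is_zero_obj S z"
  unfolding is_zero_obj_def Obj_S
proof (intro conjI ballI)
  show zF: "z \<in> \<F>" by (rule zero_obj_mem[OF z])
  fix a assume a: "a \<in> \<F>"
  then have "a \<in> Obj C" using sub by blast
  then show "\<exists>!f. f \<in> hom S a z" "\<exists>!f. f \<in> hom S z a"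
    using z unfolding hom_S[OF a zF] hom_S[OF zF a] is_zero_obj_def by simp_all
qed

lemma pointed_category_S: "pointed_category S"
proof
  show "is_category S" by (rule is_category_S)
  show "is_pointed S"
    using is_category_S zero_obj_S pointed unfolding is_pointed_def by blast
qed

lemma zero_arr_S: assumes "a \<in> \<F>" "b \<in> \<F>" shows "zero_arr S a b = zero_arr C a b"
proof -
  obtain z g h where z: "is_zero_obj C z" "g \<in> hom C a z" "h \<in> hom C z b" "zero_arr C a b = h \<cdot> g"
    by (rule zero_arr_factors[OF subsetD[OF sub assms(1)] subsetD[OF sub assms(2)]])
  have "g \<in> hom S a z" "h \<in> hom S z b" using z hom_S zero_obj_mem assms by blast+
  then show ?thesis
    using pointed_category.zero_arr_eq[OF pointed_category_S zero_obj_S[OF z(1)]] z(4) comp_S by metis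
qed

text \<open>The inclusion of \<open>S\<close> is a right adjoint and so preserves kernels; the proof
  extends a test arrow along the unit of its domain. This is needed because protoadditivity gives a
  kernel in \<open>S\<close>, whereas the split short five lemma is applied in
  \<open>C\<close>.\<close>

lemma kernel_S_imp_kernel:
  assumes ker: "is_kernel S k f"
  shows "is_kernel C k f"
proof -
  interpret S: pointed_category S by (rule pointed_category_S)
  let ?K = "Dom C k" and ?A = "Dom C f" and ?B = "Cod C f"
  have f: "f \<in> hom S ?A ?B"
    using ker unfolding is_kernel_def by (auto simp: hom_def Dom_S Cod_S)
  note k = S.is_kernelD(1,2)[OF ker f, unfolded Dom_S comp_S]
  have m: "?K \<in> \<F>" "?A \<in> \<F>" "?B \<in> \<F>" and kC: "k \<in> hom C ?K ?A" and fC: "f \<in> hom C ?A ?B"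
    using in_S k(1) f by auto
  show ?thesis
  proof (rule is_kernelI[OF kC fC])
    show "f \<cdot> k = zero_arr C ?K ?B" using k(2) zero_arr_S[OF m(1,3)] by simp
  next
    fix X h assume h: "h \<in> hom C X ?A" "f \<cdot> h = zero_arr C X ?B"
    have X: "X \<in> Obj C" using hom_obj[OF h(1)] by simp
    note FX = F_obj[OF X] and e = unit_hom[OF X]
    have FXo: "omap F X \<in> Obj C" and Bo: "?B \<in> Obj C" using FX m sub by auto
    \<comment> \<open>The test object \<open>X\<close> may lie outside \<open>\<F>\<close>;
      replacing \<open>h\<close> by its extension to \<open>omap F X\<close> gives a test arrow
      inside \<open>S\<close>.\<close>
    obtain h' where h': "h' \<in> hom C (omap F X) ?A" "h' \<cdot> \<eta> X = h"
      using unit_universal[OF h(1) m(2)] by blast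
    have "f \<cdot> h' = zero_arr C (omap F X) ?B"
      by (rule unit_ext[OF X m(3) comp_hom[OF h'(1) fC] zero_arr_hom[OF FXo Bo]])
        (simp add: comp_assoc[OF e h'(1) fC] h' h zero_arr_comp[OF e Bo])
    then have "f \<cdot>\<^bsub>S\<^esub> h' = zero_arr S (omap F X) ?B" using zero_arr_S[OF FX m(3)] comp_S by simp
    moreover have "h' \<in> hom S (omap F X) ?A" using h'(1) hom_S[OF FX m(2)] by simp
    ultimately obtain u where "u \<in> hom S (omap F X) ?K" "k \<cdot>\<^bsub>S\<^esub> u = h'"
      using S.is_kernelD(3)[OF ker f] Dom_S by metis
    then have u: "u \<in> hom C (omap F X) ?K" "k \<cdot> u = h'" using in_S comp_S by auto
    then show "\<exists>u. u \<in> hom C X ?K \<and> k \<cdot> u = h"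
      using comp_hom[OF e u(1)] comp_assoc[OF e u(1) kC] h'(2) by metis
  next
    fix X u v assume uv: "u \<in> hom C X ?K" "v \<in> hom C X ?K" "k \<cdot> u = k \<cdot> v"
    have X: "X \<in> Obj C" using hom_obj[OF uv(1)] by simp
    note FX = F_obj[OF X] and e = unit_hom[OF X]
    obtain u' v' where u': "u' \<in> hom C (omap F X) ?K" "u' \<cdot> \<eta> X = u"
      and v': "v' \<in> hom C (omap F X) ?K" "v' \<cdot> \<eta> X = v"
      using unit_universal[OF uv(1) m(1)] unit_universal[OF uv(2) m(1)] by blast
    have "k \<cdot> u' = k \<cdot> v'"
      by (rule unit_ext[OF X m(2) comp_hom[OF u'(1) kC] comp_hom[OF v'(1) kC]])
        (simp add: comp_assoc[OF e u'(1) kC] comp_assoc[OF e v'(1) kC] u' v' uv)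
    then have "u' = v'"
      using S.is_kernel_ext[OF ker f, of u' "omap F X" v'] u'(1) v'(1) hom_S[OF FX m(1)]
      by (simp add: Dom_S comp_S)
    then show "u = v" using u'(2) v'(2) by simp
  qed
qed

text \<open>Since \<open>A\<close> is in \<open>\<F>\<close>, the arrow \<open>k\<close> extends
  along the unit of the kernel object. The extension is still killed by \<open>f\<close>, so it
  factors through \<open>k\<close>, and the factor \<open>r\<close> retracts that unit.\<close>

lemma kernel_obj_mem:
  assumes ker: "is_kernel C k f" and f: "f \<in> hom C A B" and m: "A \<in> \<F>" "B \<in> \<F>"
  shows "Dom C k \<in> \<F>"
proof -
  let ?K = "Dom C k"
  note k = is_kernelD(1,2)[OF ker f]
  have K: "?K \<in> Obj C" and Bo: "B \<in> Obj C" using hom_obj k(1) f by auto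
  note e = unit_hom[OF K]
  have FK: "omap F ?K \<in> Obj C" using F_obj[OF K] sub by auto
  obtain k' where k': "k' \<in> hom C (omap F ?K) A" "k' \<cdot> \<eta> ?K = k"
    using unit_universal[OF k(1) m(1)] by blast
  have "f \<cdot> k' = zero_arr C (omap F ?K) B"
    by (rule unit_ext[OF K m(2) comp_hom[OF k'(1) f] zero_arr_hom[OF FK Bo]])
      (simp add: comp_assoc[OF e k'(1) f] k' k zero_arr_comp[OF e Bo])
  then obtain r where r: "r \<in> hom C (omap F ?K) ?K" "k \<cdot> r = k'"
    using is_kernelD(3)[OF ker f k'(1)] by blast
  have "r \<cdot> \<eta> ?K = Ide C ?K"
    by (rule is_kernel_ext[OF ker f comp_hom[OF e r(1)] ide_hom[OF K]])
      (simp add: comp_assoc[OF e r(1) k(1), symmetric] r k' comp_ide[OF k(1)])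
  then show ?thesis using retract_unit_iso K r(1) by blast
qed

text \<open>The naturality square is a pullback, so \<open>\<eta> ?A \<cdot> k\<close> is a kernel
  of \<open>amap F f\<close>, an arrow between objects of \<open>\<F>\<close>.\<close>

lemma kernel_trivial_extension_mem:
  assumes tr: "trivial_extension C F \<eta> f" and ker: "is_kernel C k f"
  shows "Dom C k \<in> \<F>"
proof -
  let ?A = "Dom C f" and ?B = "Cod C f"
  have f: "f \<in> hom C ?A ?B" and pb: "is_pullback C (\<eta> ?A) f (amap F f) (\<eta> ?B)"
    using tr arr_hom unfolding trivial_extension_def by auto
  have ob: "?A \<in> Obj C" "?B \<in> Obj C" using hom_obj[OF f] by auto
  note K = kernel_comp_pullback[OF pb unit_hom[OF ob(1)] F_hom[OF f] unit_hom[OF ob(2)] ker]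
  have "Dom C (\<eta> ?A \<cdot> k) \<in> \<F>"
    by (rule kernel_obj_mem[OF K(1) F_hom[OF f] F_obj[OF ob(1)] F_obj[OF ob(2)]])
  then show ?thesis using K(2) by (simp add: hom_def)
qed

text \<open>The domain \<open>A\<close> is compared with the pullback \<open>P\<close> of
  \<open>amap F f\<close> along the unit of \<open>B\<close>. Both are split extensions of
  \<open>B\<close>, and the comparison \<open>v\<close> induces on kernels the unit at
  \<open>?K\<close>, which is invertible because \<open>?K\<close> lies in
  \<open>\<F>\<close>.\<close>

lemma split_epi_trivial_extension:
  assumes fc: "finitely_complete C" and five: "split_short_five C"
    and pa: "is_protoadditive C S F"
    and sse: "split_short_exact C k f s" and f: "f \<in> hom C A B" and K: "Dom C k \<in> \<F>"
  shows "trivial_extension C F \<eta> f"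
proof -
  let ?K = "Dom C k"
  have ker: "is_kernel C k f" and s: "s \<in> hom C B A" "f \<cdot> s = Ide C B"
    using sse f unfolding split_short_exact_def by (auto simp: hom_def)
  note k = is_kernelD(1,2)[OF ker f]
  have ob: "A \<in> Obj C" "B \<in> Obj C" "?K \<in> Obj C" using hom_obj f k(1) by auto
  note eA = unit_hom[OF ob(1)] and eB = unit_hom[OF ob(2)] and eK = unit_hom[OF ob(3)]
  have "split_short_exact S (amap F k) (amap F f) (amap F s)"
    using pa sse unfolding is_protoadditive_def by blast
  then have kerF: "is_kernel C (amap F k) (amap F f)"
    and FsB: "amap F f \<cdot> amap F s = Ide C (omap F B)"
    using kernel_S_imp_kernel F_hom[OF f] unfolding split_short_exact_def
    by (auto simp: comp_S Ide_S Cod_S hom_def)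
  note Ff = F_hom[OF f] and Fk = F_hom[OF k(1)] and Fs = F_hom[OF s(1)]
  obtain a b where pb: "is_pullback C a b (amap F f) (\<eta> B)"
    using finitely_complete_pullback[OF fc Ff eB] by blast
  define P where "P = Dom C a"
  have a: "a \<in> hom C P (omap F A)" using pb Ff unfolding is_pullback_def hom_def P_def by auto
  note pbh = a Ff eB
  note b = is_pullbackD(1,2)[OF pb pbh]
  have DFk: "Dom C (amap F k) = omap F ?K" using Fk by (simp add: hom_def)
  \<comment> \<open>The kernel of the projection \<open>b\<close> is inherited from
    \<open>amap F k\<close>, so its object is \<open>omap F ?K\<close>.\<close>
  obtain kb where kb: "is_kernel C kb b" "kb \<in> hom C (omap F ?K) P" "a \<cdot> kb = amap F k"
    using kernel_of_pullback[OF pb pbh kerF] DFk by metis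
  have Dkb: "Dom C kb = omap F ?K" using kb(2) by (simp add: hom_def)
  have "amap F f \<cdot> (amap F s \<cdot> \<eta> B) = \<eta> B \<cdot> Ide C B"
    using comp_assoc[OF eB Fs Ff] FsB ide_comp[OF eB] comp_ide[OF eB] by simp
  \<comment> \<open>The section of \<open>b\<close> induced by the reflected section
    \<open>amap F s\<close>.\<close>
  then obtain t where t: "t \<in> hom C B P" "a \<cdot> t = amap F s \<cdot> \<eta> B" "b \<cdot> t = Ide C B"
    using is_pullbackD(3)[OF pb pbh comp_hom[OF eB Fs] ide_hom[OF ob(2)]] by blast
  obtain v where v: "v \<in> hom C A P" "a \<cdot> v = \<eta> A" "b \<cdot> v = f"
    using is_pullbackD(3)[OF pb pbh eA f] unit_natural[OF f] by auto
  have "split_short_exact C kb b t"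
    using kb(1) t b(1) unfolding split_short_exact_def by (auto simp: hom_def)
  moreover have "v \<cdot> k = kb \<cdot> \<eta> ?K"
  proof (rule is_pullback_ext[OF pb pbh comp_hom[OF k(1) v(1)] comp_hom[OF eK kb(2)]])
    show "a \<cdot> (v \<cdot> k) = a \<cdot> (kb \<cdot> \<eta> ?K)"
      using comp_assoc[OF k(1) v(1) a] comp_assoc[OF eK kb(2) a] v(2) kb(3) unit_natural[OF k(1)]
      by simp
    have "b \<cdot> kb = zero_arr C (omap F ?K) B" using is_kernelD(2)[OF kb(1) b(1)] Dkb by simp
    then show "b \<cdot> (v \<cdot> k) = b \<cdot> (kb \<cdot> \<eta> ?K)"
      using comp_assoc[OF k(1) v(1) b(1)] comp_assoc[OF eK kb(2) b(1)] v(3) k(2)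
        zero_arr_comp[OF eK ob(2)] by simp
  qed
  moreover have "v \<cdot> s = t"
  proof (rule is_pullback_ext[OF pb pbh comp_hom[OF s(1) v(1)] t(1)])
    show "a \<cdot> (v \<cdot> s) = a \<cdot> t"
      using comp_assoc[OF s(1) v(1) a] v(2) t(2) unit_natural[OF s(1)] by simp
    show "b \<cdot> (v \<cdot> s) = b \<cdot> t"
      using comp_assoc[OF s(1) v(1) b(1)] v(3) t(3) s(2) by simp
  qed
  then have "v \<cdot> s = t \<cdot> Ide C B" using comp_ide[OF t(1)] by simp
  moreover have "b \<cdot> v = Ide C B \<cdot> f" using v(3) ide_comp[OF f] by simp
  moreover have "is_iso C (Ide C B)"
    using is_isoI ide_hom[OF ob(2)] comp_ide[OF ide_hom[OF ob(2)]] by blast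
  moreover have "Dom C f = A" "Cod C f = B" "Dom C b = P" "Cod C b = B"
    using f b(1) by (auto simp: hom_def)
  ultimately have "is_iso C v"
    \<comment> \<open>The outer arrows of the morphism of split sequences are the unit at
      \<open>?K\<close> and the identity of \<open>B\<close>, both invertible, so the middle arrow
      \<open>v\<close> is too.\<close>
    using five[unfolded split_short_five_def, rule_format, OF sse, of kb b t "\<eta> ?K" v "Ide C B"]
      eK v(1) ide_hom[OF ob(2)] unit_iso[OF K] Dkb by simp
  then have "is_pullback C (a \<cdot> v) (b \<cdot> v) (amap F f) (\<eta> B)"
    by (rule is_pullback_iso_comp[OF pb pbh v(1)])
  then show ?thesis
    using v f unfolding trivial_extension_def by (auto simp: hom_def)
qed

end

section \<open>Normality, centrality and torsion-freeness of the kernel\<close>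

theorem proposition3p3:
  fixes C :: "('o, 'm) category"
    and \<T> \<F> :: "'o set"
    and F :: "('o, 'm, 'o, 'm) cfunctor"
    and \<eta> :: "'o \<Rightarrow> 'm"
    and f :: 'm
  assumes "is_homological C"
    and "is_torsion_theory C \<T> \<F>"
    and "is_reflection C \<F> F \<eta>"
    and "is_protoadditive C (full_subcat C \<F>) F"
    and "effective_descent C f"
  shows "(normal_extension C F \<eta> f \<longleftrightarrow> central_extension C F \<eta> f) \<and>
         (central_extension C F \<eta> f \<longleftrightarrow> ker_obj C f \<in> \<F>)"
proof -
  have pointed: "is_pointed C" and five: "split_short_five C" and fc: "finitely_complete C"
    using assms(1) unfolding is_homological_def is_protomodular_def is_regular_def by auto
  interpret reflection C \<F> F \<eta>
  proof
    show "is_category C" using pointed unfolding is_pointed_def by (elim conjE)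
    show "\<F> \<subseteq> Obj C" "replete C \<F>" using assms(2) unfolding is_torsion_theory_def by simp_all
  qed (rule pointed, rule assms(3))
  define A B where "A = Dom C f" and "B = Cod C f"
  have f: "f \<in> hom C A B"
    using assms(5) arr_hom unfolding effective_descent_def A_def B_def by blast
  define k where "k = (SOME k. is_kernel C k f)"
  have ker: "is_kernel C k f"
    using someI_ex[OF kernel_exists[OF fc f]] unfolding k_def .
  have K: "ker_obj C f = Dom C k" unfolding ker_obj_def k_def ..
  have pb: "is_pullback C (pb_along C p f) (pb_proj C p f) p f" if "p \<in> hom C E B" for p E
    by (rule is_pullback_chosen[OF finitely_complete_pullback[OF fc that f]])
  have ker_pb: "\<exists>k'. is_kernel C k' (pb_along C p f) \<and> Dom C k' = Dom C k"
    if p: "p \<in> hom C E B" for p E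
  proof -
    \<comment> \<open>The square is flipped so that \<open>f\<close> and
      \<open>pb_along C p f\<close> are opposite sides, as \<open>kernel_of_pullback\<close>
      expects.\<close>
    note pbs = is_pullback_sym[OF pb[OF p]]
    have "pb_proj C p f \<in> hom C (Dom C (pb_proj C p f)) A"
      using pbs f unfolding is_pullback_def hom_def by auto
    from kernel_of_pullback[OF pbs this f p ker] show ?thesis
      by (metis (mono_tags, lifting) hom_def mem_Collect_eq)
  qed
  \<comment> \<open>The arrow \<open>f\<close> itself serves as the effective descent morphism
    \<open>p\<close>.\<close>
  have "central_extension C F \<eta> f" if "normal_extension C F \<eta> f"
    using that assms(5) unfolding normal_extension_def central_extension_def effective_descent_def
    by blast
  moreover have "ker_obj C f \<in> \<F>" if central: "central_extension C F \<eta> f"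
  proof -
    obtain p where "effective_descent C p" "Cod C p = B"
      and tr: "trivial_extension C F \<eta> (pb_along C p f)"
      using central unfolding central_extension_def B_def by blast
    then have "p \<in> hom C (Dom C p) B" unfolding effective_descent_def hom_def by auto
    then show ?thesis using ker_pb kernel_trivial_extension_mem[OF tr] K by metis
  qed
  moreover have "normal_extension C F \<eta> f" if "ker_obj C f \<in> \<F>"
  proof -
    let ?p = "pb_along C f f"
    have A: "A \<in> Obj C" using hom_obj[OF f] by simp
    have p: "?p \<in> hom C (Dom C ?p) A" using pb[OF f] f unfolding is_pullback_def hom_def by auto
    \<comment> \<open>The diagonal into the kernel pair of \<open>f\<close>, induced by two
      identities, splits the projection \<open>?p\<close>.\<close>
    obtain s where s: "s \<in> hom C A (Dom C ?p)" "?p \<cdot>\<^bsub>C\<^esub> s = Ide C A"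
      using is_pullbackD(3)[OF pb[OF f] p f f ide_hom[OF A] ide_hom[OF A]] by blast
    obtain k' where "is_kernel C k' ?p" "Dom C k' = Dom C k" using ker_pb[OF f] by blast
    moreover from this s p have "split_short_exact C k' ?p s"
      unfolding split_short_exact_def by (auto simp: hom_def)
    ultimately have "trivial_extension C F \<eta> ?p"
      using split_epi_trivial_extension[OF fc five assms(4) _ p] that K by simp
    then show ?thesis using assms(5) unfolding normal_extension_def by blast
  qed
  ultimately show ?thesis by blast
qed

end
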